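(* Let $d\ge1$, $-\frac d2<s<1$, and let $\omega\in\mathbb S^{d-1}$ be an arbitrary fixed unit vector. Suppose $\chi\in C_c^\infty(\mathbb R^d)$ is a radial function with $\chi(\eta)=1$ for $|\eta|\le\frac12$ and $\chi(\eta)=0$ for $|\eta|\ge1$. Then the limit $$A_{s,d}:=\lim_{N\to\infty}\int_{\mathbb R^d}|\eta|^{2s}\,\chi\Bigl(\frac\eta N\Bigr)\,e^{i\omega\cdot\eta}\,d\eta$$ exists, is finite, and depends only on $d$ and $s$, not on the particular choice of $\chi$ or of $\omega$.
   Context: $|\cdot|$ is the Euclidean norm on $\mathbb R^d$ and $\mathbb S^{d-1}$ the unit sphere (for $d=1$, $\mathbb S^0=\{\pm1\}$). *)

theory Defs
  imports "HOL-Analysis.Analysis"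
begin

text \<open>
  \<open>C_k k f\<close> says that \<open>f\<close> is \<open>k\<close> times continuously differentiable on the whole space: all iterated
  directional derivatives of order less than \<open>k\<close> are (Frechet) differentiable everywhere, and those
  of order \<open>k\<close> are continuous.
\<close>

primrec C_k :: "nat \<Rightarrow> ('a::real_normed_vector \<Rightarrow> 'b::real_normed_vector) \<Rightarrow> bool" where
  "C_k 0 f \<longleftrightarrow> continuous_on UNIV f"
| "C_k (Suc k) f \<longleftrightarrow>
     (\<forall>x. f differentiable (at x)) \<and> (\<forall>v. C_k k (\<lambda>x. frechet_derivative f (at x) v))"

definition smooth :: "('a::real_normed_vector \<Rightarrow> 'b::real_normed_vector) \<Rightarrow> bool" where
  "smooth f \<longleftrightarrow> (\<forall>k. C_k k f)"

definition test_function :: "('a::real_normed_vector \<Rightarrow> 'b::real_normed_vector) \<Rightarrow> bool" where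
  "test_function f \<longleftrightarrow> smooth f \<and> compact (closure {x. f x \<noteq> 0})"

definition radial :: "('a::real_normed_vector \<Rightarrow> 'b) \<Rightarrow> bool" where
  "radial f \<longleftrightarrow> (\<forall>x y. norm x = norm y \<longrightarrow> f x = f y)"

text \<open>
  The cutoff is called \<open>\<phi>\<close> because the symbol chi is the binder for vectors in the library. It may be complex
  valued, which covers the real-valued case.
\<close>

definition radial_cutoff :: "('a::real_normed_vector \<Rightarrow> complex) \<Rightarrow> bool" where
  "radial_cutoff \<phi> \<longleftrightarrow> test_function \<phi> \<and> radial \<phi> \<and>
     (\<forall>\<eta>. norm \<eta> \<le> 1/2 \<longrightarrow> \<phi> \<eta> = 1) \<and> (\<forall>\<eta>. norm \<eta> \<ge> 1 \<longrightarrow> \<phi> \<eta> = 0)"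

text \<open>
  At \<open>\<eta> = 0\<close> the library has \<open>0 powr a = 0\<close> for every \<open>a\<close>; this concerns a null set only.
\<close>

definition cutoff_integrand ::
  "real \<Rightarrow> (real^'n \<Rightarrow> complex) \<Rightarrow> real^'n \<Rightarrow> real \<Rightarrow> real^'n \<Rightarrow> complex" where
  "cutoff_integrand s \<phi> \<omega> N \<eta> =
     of_real (norm \<eta> powr (2 * s)) * \<phi> (\<eta> /\<^sub>R N) * exp (\<i> * of_real (\<omega> \<bullet> \<eta>))"

end

theory Submission
  imports Defs
begin

text \<open>
  Write \<open>I(\<phi>, \<omega>, N)\<close> for the integral of \<open>cutoff_integrand s \<phi> \<omega> N\<close>, and \<open>d\<close> for the dimension.

  The proof rests on one estimate, \<open>cutoff_integral_rapid_decay\<close>: if a smooth \<open>\<psi>\<close> has bounded support and vanishes near the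
  origin, then \<open>I(\<psi>, \<omega>, N)\<close> tends to 0 faster than any power of \<open>1 / N\<close>. Indeed, substituting
  \<open>\<eta> = N x\<close> turns it into \<open>N powr (d + 2 s)\<close> times the Fourier integral, at frequency \<open>N \<omega>\<close>, of
  \<open>norm x powr (2 s) * \<psi> x\<close>, which is a smooth function with bounded support because \<open>\<psi>\<close> removes the
  singularity of the weight. Sufficiently many integrations by parts beat the prefactor.

  A cutoff \<open>\<phi>\<close> is not of this kind, since it is 1 near the origin. But the existence and uniqueness of the limit
  concern only the variation in \<open>N\<close> and the difference of two cutoffs, and in both the constant 1 cancels:
  \<^item> The derivative of \<open>\<phi> (\<eta> / N)\<close> in \<open>N\<close> is \<open>- \<psi> (\<eta> / N) / N\<close>, where \<open>\<psi>\<close> is the radial derivative of \<open>\<phi>\<close>.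
    It vanishes near the origin, so the derivative of \<open>I(\<phi>, \<omega>, N)\<close> in \<open>N\<close> is \<open>O(1 / N\<^sup>2)\<close>, and the limit
    exists (\<open>cutoff_integral_converges\<close>).
  \<^item> For two cutoffs the difference \<open>\<psi> = \<phi> - \<phi>\<^sub>0\<close> vanishes near the origin, so \<open>I(\<phi>, \<omega>, N)\<close> and
    \<open>I(\<phi>\<^sub>0, \<omega>, N)\<close> have the same limit.
  \<^item> Two unit vectors are related by an orthogonal transformation. Lebesgue measure, the norm and a radial cutoff are
    invariant under it, so \<open>I(\<phi>, \<omega>, N)\<close> is the same for both (\<open>cutoff_integral_orthogonal_invariant\<close>).

  The bound \<open>s > - d / 2\<close> makes \<open>norm \<eta> powr (2 s)\<close> integrable at the origin, which a decomposition into dyadic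
  shells shows (\<open>integrable_norm_powr_on_unit_ball\<close>).
\<close>

section \<open>Calculus of \<open>C_k\<close> functions\<close>

lemma C_k_Suc_imp_C_k: "C_k (Suc k) f \<Longrightarrow> C_k k f"
proof (induction k arbitrary: f)
  case 0
  then show ?case
    by (auto intro!: continuous_at_imp_continuous_on differentiable_imp_continuous_within)
next
  case (Suc k)
  then show ?case by (metis C_k.simps(2))
qed

lemma C_k_continuous: "C_k k f \<Longrightarrow> continuous_on UNIV f"
  by (induction k) (auto intro!: continuous_at_imp_continuous_on differentiable_imp_continuous_within)

lemma C_k_const: "C_k k (\<lambda>x. c)"
  by (induction k arbitrary: c) auto

lemma C_k_bounded_linear:
  assumes "bounded_linear f"
  shows "C_k k f"
proof (cases k)
  case 0
  then show ?thesis
    using assms by (simp add: linear_continuous_on)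
next
  case (Suc m)
  have D: "(f has_derivative f) (at x)" for x
    using assms by (simp add: bounded_linear_imp_has_derivative)
  then have "frechet_derivative f (at x) = f" for x
    using frechet_derivative_at by metis
  then show ?thesis
    using D Suc by (auto simp: C_k_const differentiable_def)
qed

lemma C_k_add:
  assumes "C_k k f" "C_k k g"
  shows "C_k k (\<lambda>x. f x + g x)"
  using assms
proof (induction k arbitrary: f g)
  case 0
  then show ?case by (simp add: continuous_on_add)
next
  case (Suc k)
  have "frechet_derivative (\<lambda>x. f x + g x) (at x) v
      = frechet_derivative f (at x) v + frechet_derivative g (at x) v" for x v
    using Suc.prems frechet_derivative_at[OF has_derivative_add[of f "frechet_derivative f (at x)" "at x" g "frechet_derivative g (at x)"]]
    by (simp add: frechet_derivative_works) metis
  then show ?case using Suc by (simp add: differentiable_add)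
qed

lemma C_k_sum:
  assumes "\<And>i. i \<in> I \<Longrightarrow> C_k k (f i)"
  shows "C_k k (\<lambda>x. \<Sum>i\<in>I. f i x)"
  using assms
  by (induction I rule: infinite_finite_induct) (auto simp: C_k_const C_k_add)

lemma C_k_mult:
  fixes f g :: "'a::real_normed_vector \<Rightarrow> 'b::real_normed_algebra"
  assumes "C_k k f" "C_k k g"
  shows "C_k k (\<lambda>x. f x * g x)"
  using assms
proof (induction k arbitrary: f g)
  case 0
  then show ?case by (simp add: continuous_on_mult)
next
  case (Suc k)
  have "frechet_derivative (\<lambda>x. f x * g x) (at x) v
      = f x * frechet_derivative g (at x) v + frechet_derivative f (at x) v * g x" for x v
    using Suc.prems frechet_derivative_at[OF has_derivative_mult[of f "frechet_derivative f (at x)" x UNIV g "frechet_derivative g (at x)"]]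
    by (simp add: frechet_derivative_works) metis
  moreover have "C_k k f" "C_k k g"
    using Suc.prems C_k_Suc_imp_C_k by blast+
  ultimately show ?case using Suc by (simp add: differentiable_mult C_k_add)
qed

lemma C_k_diff:
  fixes f g :: "'a::real_normed_vector \<Rightarrow> 'b::real_normed_algebra_1"
  assumes "C_k k f" "C_k k g"
  shows "C_k k (\<lambda>x. f x - g x)"
  using C_k_add[OF assms(1) C_k_mult[OF C_k_const[of k "-1"] assms(2)]] by simp

lemma frechet_derivative_eq_0_if_locally_const:
  assumes "open S" "x \<in> S" "\<And>y. y \<in> S \<Longrightarrow> f y = c"
  shows "frechet_derivative f (at x) v = 0"
proof -
  have "(f has_derivative (\<lambda>_. 0)) (at x)"
    by (rule has_derivative_transform_within_open[OF has_derivative_const[of c], of S]) (use assms in auto)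
  then show ?thesis
    by (simp only: frechet_derivative_at[symmetric])
qed

text \<open>
  The derivative of \<open>norm x powr a\<close> is again a power of the norm, with exponent \<open>a - 2\<close>, times a linear
  function. Keeping this shape lets the next lemma differentiate repeatedly.
\<close>

lemma has_derivative_norm_powr:
  fixes x :: "'a::real_inner"
  assumes "x \<noteq> 0"
  shows "((\<lambda>x. norm x powr a) has_derivative (\<lambda>v. a * norm x powr (a - 2) * (x \<bullet> v))) (at x)"
proof -
  have "((\<lambda>x. norm x powr a) has_derivative (\<lambda>v. (v \<bullet> sgn x) * (a * norm x powr (a - 1)))) (at x)"
    using assms has_derivative_in_compose[OF has_derivative_norm[OF assms], of "\<lambda>r. r powr a"
        "\<lambda>h. h * (a * norm x powr (a - 1))"] 
        has_real_derivative_powr[of "norm x" a]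
    by (auto simp: has_field_derivative_def mult.commute[of _ "a * _"] has_derivative_at_withinI
       intro: has_derivative_subset)
  moreover have "norm x powr (a - 1) = norm x * norm x powr (a - 2)"
    using assms powr_add[of "norm x" 1 "a - 2"] by simp
  ultimately show ?thesis
    using assms by (simp add: sgn_div_norm inner_commute field_simps)
qed

text \<open>
  The singularity of a power of the norm sits at the origin only, so it is harmless next to a factor that
  vanishes near the origin. By the product rule the derivative of \<open>norm x powr a * \<psi> x\<close> is a sum of two
  functions of the same kind, with exponents \<open>a - 2\<close> and \<open>a\<close>, so the induction runs with \<open>a\<close> and \<open>\<psi>\<close>
  arbitrary.
\<close>

lemma C_k_norm_powr_mult:
  fixes \<psi> :: "'a::real_inner \<Rightarrow> complex"
  assumes "C_k k \<psi>" "0 < \<epsilon>" "\<And>x. norm x < \<epsilon> \<Longrightarrow> \<psi> x = 0"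
  shows "C_k k (\<lambda>x. of_real (norm x powr a) * \<psi> x)"
  using assms
proof (induction k arbitrary: a \<psi>)
  case 0
  let ?f = "\<lambda>x. of_real (norm x powr a) * \<psi> x"
  have "continuous (at x) ?f" for x
  proof (cases "norm x < \<epsilon>")
    case True
    have "(?f has_derivative (\<lambda>_. 0)) (at x)"
      by (rule has_derivative_transform_within_open[OF has_derivative_const[of 0], where s="ball 0 \<epsilon>"])
         (use True 0 in auto)
    then show ?thesis by (rule has_derivative_continuous)
  next
    case False
    then have "x \<noteq> 0" using 0 by auto
    moreover have "continuous (at x) \<psi>"
      using 0 by (simp add: continuous_on_eq_continuous_at)
    ultimately show ?thesis by (intro continuous_intros) auto
  qed
  then show ?case by (simp add: continuous_at_imp_continuous_on)
next
  case (Suc k)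
  let ?f = "\<lambda>x. complex_of_real (norm x powr a) * \<psi> x"
  let ?D = "\<lambda>x v. of_real (norm x powr (a - 2)) * (of_real (a * (x \<bullet> v)) * \<psi> x)
                + of_real (norm x powr a) * frechet_derivative \<psi> (at x) v"
  have \<psi>': "frechet_derivative \<psi> (at x) v = 0" if "norm x < \<epsilon>" for x v
    using that Suc.prems by (intro frechet_derivative_eq_0_if_locally_const[of "ball 0 \<epsilon>" _ _ 0]) auto
  have D: "(?f has_derivative ?D x) (at x)" for x
  proof (cases "norm x < \<epsilon>")
    case True
    have "(?f has_derivative (\<lambda>_. 0)) (at x)"
      by (rule has_derivative_transform_within_open[OF has_derivative_const[of 0], where s="ball 0 \<epsilon>"])
         (use True Suc.prems in auto)
    then show ?thesis using True Suc.prems \<psi>' by simp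
  next
    case False
    then have "x \<noteq> 0" using Suc.prems by auto
    then have "(?f has_derivative (\<lambda>v. of_real (norm x powr a) * frechet_derivative \<psi> (at x) v
        + of_real (a * norm x powr (a - 2) * (x \<bullet> v)) * \<psi> x)) (at x)"
      using Suc.prems has_derivative_norm_powr[of x a]
      by (intro has_derivative_mult has_derivative_of_real) (auto simp: frechet_derivative_works[symmetric])
    then show ?thesis by (rule has_derivative_eq_rhs) (auto simp: algebra_simps)
  qed
  have "C_k k (\<lambda>x. ?D x v)" for v
  proof (rule C_k_add)
    have "C_k k (\<lambda>x. complex_of_real (a * (x \<bullet> v)))"
      by (intro C_k_bounded_linear bounded_linear_compose[OF bounded_linear_of_real]
          bounded_linear_compose[OF bounded_linear_mult_right] bounded_linear_inner_left)
    then show "C_k k (\<lambda>x. of_real (norm x powr (a - 2)) * (of_real (a * (x \<bullet> v)) * \<psi> x))"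
      using Suc.prems C_k_Suc_imp_C_k by (intro Suc.IH C_k_mult) auto
    show "C_k k (\<lambda>x. of_real (norm x powr a) * frechet_derivative \<psi> (at x) v)"
      using Suc.prems \<psi>' by (intro Suc.IH) auto
  qed
  moreover have "frechet_derivative ?f (at x) v = ?D x v" for x v
    by (simp only: frechet_derivative_at[OF D, symmetric])
  moreover have "?f differentiable (at x)" for x
    using D unfolding differentiable_def by blast
  ultimately show ?case by simp
qed

text \<open>
  The function \<open>\<lambda>x. frechet_derivative \<phi> (at x) x\<close> is the radial (Euler) derivative \<open>x \<cdot> \<nabla>\<phi>\<close>. It governs how
  \<open>\<phi> (\<eta> / N)\<close> changes with \<open>N\<close>. Its direction varies with the point, so its smoothness is read off
  from the expansion in the directional derivatives along the basis vectors.
\<close>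

lemma C_k_radial_derivative:
  fixes \<phi> :: "'a::euclidean_space \<Rightarrow> complex"
  assumes "C_k (Suc k) \<phi>"
  shows "C_k k (\<lambda>x. frechet_derivative \<phi> (at x) x)"
proof -
  have "frechet_derivative \<phi> (at x) x
      = (\<Sum>b\<in>Basis. of_real (x \<bullet> b) * frechet_derivative \<phi> (at x) b)" for x
  proof -
    have lin: "linear (frechet_derivative \<phi> (at x))"
      using assms by (simp add: linear_frechet_derivative)
    have "frechet_derivative \<phi> (at x) x
        = frechet_derivative \<phi> (at x) (\<Sum>b\<in>Basis. (x \<bullet> b) *\<^sub>R b)"
      by (simp add: euclidean_representation)
    also have "\<dots> = (\<Sum>b\<in>Basis. of_real (x \<bullet> b) * frechet_derivative \<phi> (at x) b)"
      by (simp only: linear_sum[OF lin] linear_scale[OF lin] scaleR_conv_of_real)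
    finally show ?thesis .
  qed
  moreover have "C_k k (\<lambda>x. complex_of_real (x \<bullet> b))" for b :: 'a
    by (intro C_k_bounded_linear bounded_linear_compose[OF bounded_linear_of_real]
        bounded_linear_inner_left)
  ultimately show ?thesis
    using assms by (simp add: C_k_sum C_k_mult)
qed

section \<open>Decay of oscillatory integrals\<close>

lemma integrable_continuous_bounded_support:
  fixes g :: "'a::euclidean_space \<Rightarrow> 'b::{banach, second_countable_topology}"
  assumes "continuous_on UNIV g" "\<And>x. R < norm x \<Longrightarrow> g x = 0"
  shows "integrable lborel g"
proof -
  have "integrable lborel (\<lambda>x. indicator (cball 0 R) x *\<^sub>R g x)"
    using assms by (intro borel_integrable_compact) (auto intro: continuous_on_subset)
  moreover have "(\<lambda>x. indicator (cball 0 R) x *\<^sub>R g x) = g"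
    using assms by (auto simp: indicator_def fun_eq_iff)
  ultimately show ?thesis by simp
qed

lemma integral_cbox_eq_lborel:
  fixes g :: "'a::euclidean_space \<Rightarrow> 'b::euclidean_space"
  assumes "integrable lborel g" "\<And>x. x \<notin> cbox a b \<Longrightarrow> g x = 0"
  shows "g integrable_on cbox a b" "integral (cbox a b) g = (LINT x|lborel. g x)"
proof -
  have "(g has_integral (LINT x|lborel. g x)) UNIV"
    using assms by (simp add: has_integral_integral_lborel)
  moreover have "(\<lambda>x. if x \<in> cbox a b then g x else 0) = g"
    using assms by auto
  ultimately have "(g has_integral (LINT x|lborel. g x)) (cbox a b)"
    using has_integral_restrict_UNIV[of "cbox a b" g] by metis
  then show "g integrable_on cbox a b" "integral (cbox a b) g = (LINT x|lborel. g x)"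
    by (auto simp: integral_unique)
qed

lemma lborel_integral_translate:
  fixes f :: "'a::euclidean_space \<Rightarrow> 'b::{banach, second_countable_topology}"
  assumes "f \<in> borel_measurable borel"
  shows "(LINT x|lborel. f (x + c)) = (LINT x|lborel. f x)"
proof -
  have "(LINT x|lborel. f x) = (LINT x|distr lborel borel ((+) c). f x)"
    by (simp add: lborel_distr_plus)
  also have "\<dots> = (LINT x|lborel. f (c + x))"
    using assms by (intro integral_distr) auto
  finally show ?thesis by (simp add: add.commute)
qed

lemma lborel_integral_scaleR:
  fixes f :: "'a::euclidean_space \<Rightarrow> complex"
  assumes "f \<in> borel_measurable borel" "0 < c"
  shows "(LINT x|lborel. f x) = of_real (c ^ DIM('a)) * (LINT x|lborel. f (c *\<^sub>R x))"
proof -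
  have "(LINT x|lborel. f x)
      = (LINT x|density (distr lborel borel (\<lambda>x::'a. 0 + c *\<^sub>R x)) (\<lambda>_. ennreal (c ^ DIM('a))). f x)"
    using lborel_affine[of c "0::'a"] assms(2) by simp
  also have "\<dots> = (LINT x|distr lborel borel (\<lambda>x::'a. 0 + c *\<^sub>R x). c ^ DIM('a) *\<^sub>R f x)"
    using assms by (intro integral_density) auto
  also have "\<dots> = (LINT x|lborel. c ^ DIM('a) *\<^sub>R f (0 + c *\<^sub>R x))"
    using assms by (intro integral_distr) auto
  finally show ?thesis by (simp add: scaleR_conv_of_real)
qed

lemma obtain_cbox:
  obtains a b :: "'a::euclidean_space" where "cball 0 R \<subseteq> cbox a b"
  using bounded_subset_cbox_symmetric[OF bounded_cball] by metis

text \<open>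
  Integration by parts without boundary terms. By translation invariance the integral of \<open>g (x + t v)\<close> does not
  depend on \<open>t\<close>; differentiating at \<open>t = 0\<close> under the integral sign gives the claim. For \<open>\<bar>t\<bar> < 1\<close> all translates
  are supported in one box, so that the Leibniz rule for boxes applies.
\<close>

lemma integral_directional_derivative_eq_0:
  fixes g :: "'a::euclidean_space \<Rightarrow> 'b::euclidean_space"
  assumes diff: "\<And>x. g differentiable (at x)"
    and cont: "continuous_on UNIV (\<lambda>x. frechet_derivative g (at x) v)"
    and supp: "\<And>x. R < norm x \<Longrightarrow> g x = 0"
  shows "(LINT x|lborel. frechet_derivative g (at x) v) = 0"
proof -
  obtain a b :: 'a where ab: "cball 0 (R + norm v) \<subseteq> cbox a b"
    by (rule obtain_cbox)
  let ?U = "{-1<..<1::real}"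
  let ?g' = "\<lambda>x. frechet_derivative g (at x) v"
  have g_cont: "continuous_on UNIV g"
    using diff by (simp add: continuous_at_imp_continuous_on differentiable_imp_continuous_within)
  have out: "R < norm (x + t *\<^sub>R v)" if "x \<notin> cbox a b" "t \<in> ?U" for x t
  proof -
    have "R + norm v < norm x" using that ab by (meson mem_cball_0 not_le subsetD)
    moreover have "norm x \<le> norm (x + t *\<^sub>R v) + norm (t *\<^sub>R v)"
      using norm_triangle_ineq4[of "x + t *\<^sub>R v" "t *\<^sub>R v"] by simp
    moreover have "norm (t *\<^sub>R v) \<le> norm v"
      using that by (auto intro!: mult_left_le_one_le)
    ultimately show ?thesis by linarith
  qed
  have int: "integrable lborel (\<lambda>x. g (x + t *\<^sub>R v))" if "t \<in> ?U" for t
  proof (rule integrable_continuous_bounded_support[where R="R + norm v"])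
    show "continuous_on UNIV (\<lambda>x. g (x + t *\<^sub>R v))"
      by (intro continuous_on_compose2[OF g_cont] continuous_intros) auto
    fix x :: 'a assume x: "R + norm v < norm x"
    have "norm x \<le> norm (x + t *\<^sub>R v) + norm (t *\<^sub>R v)"
      using norm_triangle_ineq4[of "x + t *\<^sub>R v" "t *\<^sub>R v"] by simp
    moreover have "norm (t *\<^sub>R v) \<le> norm v"
      using that by (auto intro!: mult_left_le_one_le)
    ultimately show "g (x + t *\<^sub>R v) = 0" using x by (intro supp) linarith
  qed
  have eq: "integral (cbox a b) (\<lambda>x. g (x + t *\<^sub>R v)) = (LINT x|lborel. g x)" if "t \<in> ?U" for t
  proof -
    have "integral (cbox a b) (\<lambda>x. g (x + t *\<^sub>R v)) = (LINT x|lborel. g (x + t *\<^sub>R v))"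
      using out that supp int by (intro integral_cbox_eq_lborel(2)) auto
    also have "\<dots> = (LINT x|lborel. g x)"
      using g_cont by (intro lborel_integral_translate) (auto intro: borel_measurable_continuous_onI)
    finally show ?thesis .
  qed
  have "((\<lambda>t. integral (cbox a b) (\<lambda>x. g (x + t *\<^sub>R v))) has_vector_derivative
      integral (cbox a b) (\<lambda>x. ?g' (x + 0 *\<^sub>R v))) (at 0 within ?U)"
  proof (rule leibniz_rule_vector_derivative)
    fix t x
    have "(g has_derivative frechet_derivative g (at (x + t *\<^sub>R v))) (at (x + t *\<^sub>R v))"
      using diff frechet_derivative_works by blast
    then have "((\<lambda>t. g (x + t *\<^sub>R v)) has_derivative
        (\<lambda>h. frechet_derivative g (at (x + t *\<^sub>R v)) (h *\<^sub>R v))) (at t within ?U)"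
      by (rule has_derivative_compose[rotated]) (auto intro!: derivative_eq_intros)
    moreover have "linear (frechet_derivative g (at (x + t *\<^sub>R v)))"
      using diff by (simp add: linear_frechet_derivative)
    ultimately show "((\<lambda>t. g (x + t *\<^sub>R v)) has_vector_derivative ?g' (x + t *\<^sub>R v)) (at t within ?U)"
      by (simp add: has_vector_derivative_def linear_scale)
  next
    show "(\<lambda>x. g (x + t *\<^sub>R v)) integrable_on cbox a b" if "t \<in> ?U" for t
      using out that supp int by (intro integral_cbox_eq_lborel(1)) auto
    show "continuous_on (?U \<times> cbox a b) (\<lambda>(t, x). ?g' (x + t *\<^sub>R v))"
      unfolding split_beta by (intro continuous_on_compose2[OF cont] continuous_intros) auto
  qed auto
  then have "((\<lambda>t. LINT x|lborel. g x) has_vector_derivative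
      integral (cbox a b) (\<lambda>x. ?g' (x + 0 *\<^sub>R v))) (at 0 within ?U)"
    by (rule has_vector_derivative_transform[rotated 2]) (use eq in auto)
  then have "((\<lambda>t. LINT x|lborel. g x) has_vector_derivative integral (cbox a b) ?g') (at 0)"
    by (subst (asm) at_within_open) auto
  then have 0: "integral (cbox a b) ?g' = 0"
    using vector_derivative_unique_at has_vector_derivative_const by blast
  have g'0: "?g' x = 0" if "R < norm x" for x
    using that supp by (intro frechet_derivative_eq_0_if_locally_const[of "- cball 0 R" _ _ 0]) auto
  have "integrable lborel ?g'"
    using cont g'0 by (intro integrable_continuous_bounded_support)
  then have "integral (cbox a b) ?g' = (LINT x|lborel. ?g' x)"
    using out[of _ 0] g'0 by (intro integral_cbox_eq_lborel(2)) auto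
  with 0 show ?thesis by simp
qed

text \<open>
  Each integration by parts in the direction \<open>\<omega>\<close> trades one derivative of the amplitude for one factor \<open>1 / N\<close>,
  because differentiating the exponential along the unit vector \<open>\<omega>\<close> multiplies it by \<open>\<i> N\<close>.
\<close>

lemma oscillatory_integral_decay:
  fixes G :: "'a::euclidean_space \<Rightarrow> complex"
  assumes "C_k k G" "\<And>x. R < norm x \<Longrightarrow> G x = 0" "norm \<omega> = 1"
  shows "\<exists>C. \<forall>N>0. norm (LINT x|lborel. G x * exp (\<i> * of_real (N * (\<omega> \<bullet> x)))) \<le> C / N ^ k"
  using assms(1,2)
proof (induction k arbitrary: G)
  case 0
  have "norm (LINT x|lborel. G x * exp (\<i> * of_real (N * (\<omega> \<bullet> x)))) \<le> (LINT x|lborel. norm (G x))" for N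
    using integral_norm_bound[of lborel "\<lambda>x. G x * exp (\<i> * of_real (N * (\<omega> \<bullet> x)))"]
    by (simp add: norm_mult)
  then show ?case by auto
next
  case (Suc k)
  let ?e = "\<lambda>N x. exp (\<i> * complex_of_real (N * (\<omega> \<bullet> x)))"
  let ?G' = "\<lambda>x. frechet_derivative G (at x) \<omega>"
  have G'0: "?G' x = 0" if "R < norm x" for x
    using that Suc.prems by (intro frechet_derivative_eq_0_if_locally_const[of "- cball 0 R" _ _ 0]) auto
  have G'C: "C_k k ?G'" using Suc.prems by simp
  obtain C where C: "\<And>N. N > 0 \<Longrightarrow> norm (LINT x|lborel. ?G' x * ?e N x) \<le> C / N ^ k"
    using Suc.IH[OF G'C G'0] by auto
  have Gc: "continuous_on UNIV G" and G'c: "continuous_on UNIV ?G'"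
    using Suc.prems(1) G'C by (blast intro: C_k_continuous)+
  have "norm (LINT x|lborel. G x * ?e N x) \<le> C / N ^ Suc k" if N: "N > 0" for N
  proof -
    have D: "((\<lambda>x. G x * ?e N x) has_derivative
        (\<lambda>v. G x * (?e N x * (\<i> * of_real (N * (\<omega> \<bullet> v)))) + frechet_derivative G (at x) v * ?e N x)) (at x)" for x
    proof -
      have G: "(G has_derivative frechet_derivative G (at x)) (at x)"
        using Suc.prems frechet_derivative_works by auto
      have "((\<lambda>x. \<i> * complex_of_real (N * (\<omega> \<bullet> x))) has_derivative (\<lambda>v. \<i> * of_real (N * (\<omega> \<bullet> v)))) (at x)"
        by (auto intro!: derivative_eq_intros)
      from has_derivative_compose[OF this] 
      have "(?e N has_derivative (\<lambda>v. ?e N x * (\<i> * of_real (N * (\<omega> \<bullet> v))))) (at x)"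
        using DERIV_exp[of "\<i> * complex_of_real (N * (\<omega> \<bullet> x))"] unfolding has_field_derivative_def by blast
      with G show ?thesis by (rule has_derivative_mult)
    qed
    have D\<omega>: "frechet_derivative (\<lambda>x. G x * ?e N x) (at x) \<omega>
        = \<i> * of_real N * (G x * ?e N x) + ?G' x * ?e N x" for x
      using frechet_derivative_at[OF D[of x], symmetric] assms(3)
      by (simp add: norm_eq_1)
    have "(LINT x|lborel. frechet_derivative (\<lambda>x. G x * ?e N x) (at x) \<omega>) = 0"
    proof (rule integral_directional_derivative_eq_0[where R=R])
      show "(\<lambda>x. G x * ?e N x) differentiable at x" for x
        using D unfolding differentiable_def by blast
      show "continuous_on UNIV (\<lambda>x. frechet_derivative (\<lambda>x. G x * ?e N x) (at x) \<omega>)"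
        unfolding D\<omega> by (intro continuous_intros Gc G'c)
    qed (use Suc.prems in auto)
    moreover have "integrable lborel (\<lambda>x. G x * ?e N x)"
      using Suc.prems by (intro integrable_continuous_bounded_support[where R=R] continuous_intros Gc) auto
    moreover have "integrable lborel (\<lambda>x. ?G' x * ?e N x)"
      using G'0 by (intro integrable_continuous_bounded_support[where R=R] continuous_intros G'c) auto
    ultimately have "\<i> * of_real N * (LINT x|lborel. G x * ?e N x) = - (LINT x|lborel. ?G' x * ?e N x)"
      unfolding D\<omega> by (simp add: add_eq_0_iff2)
    then have "norm (\<i> * of_real N * (LINT x|lborel. G x * ?e N x)) = norm (LINT x|lborel. ?G' x * ?e N x)"
      by (simp only: norm_minus_cancel)
    then have "N * norm (LINT x|lborel. G x * ?e N x) \<le> C / N ^ k"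
      using C[OF N] N by (simp add: norm_mult)
    then show ?thesis using N by (simp add: field_simps)
  qed
  then show ?case by blast
qed

section \<open>Orthogonal invariance of Lebesgue measure\<close>

text \<open>
  This is the uniqueness argument for Haar measure. For the indicator \<open>f\<close> of a Borel set and the indicator
  \<open>g\<close> of the unit ball, translation invariance and Fubini turn \<open>(\<integral> f (T x) dx) (\<integral> g)\<close> first into \<open>\<integral>\<integral> f (T x + y) g y\<close>, then into
  \<open>\<integral>\<integral> f y g (y - T x)\<close>. As \<open>T\<close> preserves the norm and \<open>g\<close> is radial, the inner integral over \<open>x\<close> is
  \<open>\<integral> g\<close> for every \<open>y\<close>. The ball has positive finite measure, so \<open>\<integral> g\<close> cancels.
\<close>

lemma lborel_distr_orthogonal_transformation:
  fixes T :: "'a::euclidean_space \<Rightarrow> 'a"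
  assumes T: "orthogonal_transformation T"
  shows "distr lborel borel T = lborel"
proof (rule measure_eqI)
  show "sets (distr lborel borel T) = sets lborel" by simp
  fix A assume "A \<in> sets (distr lborel borel T)"
  then have A [measurable]: "A \<in> sets borel" by simp
  have lin: "linear T"
    using T by (rule orthogonal_transformation_linear)
  then have Tm [measurable]: "T \<in> borel_measurable borel"
    by (intro borel_measurable_continuous_onI linear_continuous_on)
      (simp add: linear_conv_bounded_linear[symmetric])
  have TS: "T (inv T y) = y" for y
    using orthogonal_transformation_surj[OF T] by (rule surj_f_inv_f)
  let ?f = "indicator A :: 'a \<Rightarrow> ennreal"
  let ?g = "\<lambda>y::'a. indicator {0..1} (norm y) :: ennreal"
  have trans: "(\<integral>\<^sup>+x. h (x + c) \<partial>lborel) = (\<integral>\<^sup>+x. h x \<partial>lborel)"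
    if [measurable]: "h \<in> borel_measurable borel" for h :: "'a \<Rightarrow> ennreal" and c
  proof -
    have "(\<integral>\<^sup>+x. h x \<partial>lborel) = (\<integral>\<^sup>+x. h x \<partial>distr lborel borel ((+) c))"
      by (simp add: lborel_distr_plus)
    also have "\<dots> = (\<integral>\<^sup>+x. h (c + x) \<partial>lborel)"
      by (intro nn_integral_distr) auto
    finally show ?thesis by (simp add: add.commute)
  qed
  have "(\<integral>\<^sup>+x. ?f (T x) \<partial>lborel) * (\<integral>\<^sup>+y. ?g y \<partial>lborel)
      = (\<integral>\<^sup>+y. (\<integral>\<^sup>+x. ?f (T x) \<partial>lborel) * ?g y \<partial>lborel)"
    by (rule nn_integral_cmult[symmetric]) measurable
  also have "\<dots> = (\<integral>\<^sup>+y. (\<integral>\<^sup>+x. ?f (T (x + inv T y)) * ?g y \<partial>lborel) \<partial>lborel)"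
    by (intro nn_integral_cong) (simp add: nn_integral_multc trans[of "\<lambda>x. ?f (T x)"])
  also have "\<dots> = (\<integral>\<^sup>+y. (\<integral>\<^sup>+x. ?f (T x + y) * ?g y \<partial>lborel) \<partial>lborel)"
    by (simp add: linear_add[OF lin] TS)
  also have "\<dots> = (\<integral>\<^sup>+x. (\<integral>\<^sup>+y. ?f (T x + y) * ?g y \<partial>lborel) \<partial>lborel)"
    by (rule lborel_pair.Fubini') measurable
  also have "\<dots> = (\<integral>\<^sup>+x. (\<integral>\<^sup>+y. ?f y * ?g (y - T x) \<partial>lborel) \<partial>lborel)"
  proof (rule nn_integral_cong)
    fix x
    show "(\<integral>\<^sup>+y. ?f (T x + y) * ?g y \<partial>lborel) = (\<integral>\<^sup>+y. ?f y * ?g (y - T x) \<partial>lborel)"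
      using trans[of "\<lambda>y. ?f y * ?g (y - T x)" "T x"] by (simp add: add.commute)
  qed
  also have "\<dots> = (\<integral>\<^sup>+y. (\<integral>\<^sup>+x. ?f y * ?g (y - T x) \<partial>lborel) \<partial>lborel)"
    by (rule lborel_pair.Fubini') measurable
  also have "\<dots> = (\<integral>\<^sup>+y. ?f y * (\<integral>\<^sup>+x. ?g x \<partial>lborel) \<partial>lborel)"
  proof (rule nn_integral_cong)
    fix y
    have "norm (y - T x) = norm (x + - inv T y)" for x
    proof -
      have "y - T x = T (inv T y - x)" by (simp add: linear_diff[OF lin] TS)
      then show ?thesis
        using orthogonal_transformation_norm[OF T] by (simp add: norm_minus_commute)
    qed
    then show "(\<integral>\<^sup>+x. ?f y * ?g (y - T x) \<partial>lborel) = ?f y * (\<integral>\<^sup>+x. ?g x \<partial>lborel)"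
      by (simp add: nn_integral_cmult trans[of ?g "- inv T y"] del: add_uminus_conv_diff)
  qed
  also have "\<dots> = (\<integral>\<^sup>+y. ?f y \<partial>lborel) * (\<integral>\<^sup>+x. ?g x \<partial>lborel)"
    by (rule nn_integral_multc) measurable
  finally have eq: "(\<integral>\<^sup>+x. ?f (T x) \<partial>lborel) * (\<integral>\<^sup>+y. ?g y \<partial>lborel)
      = (\<integral>\<^sup>+x. ?f x \<partial>lborel) * (\<integral>\<^sup>+x. ?g x \<partial>lborel)" .
  have "?g = indicator (cball 0 1)"
    by (auto simp: fun_eq_iff indicator_def)
  then have g: "(\<integral>\<^sup>+y. ?g y \<partial>lborel) = emeasure lborel (cball (0::'a) 1)"
    by simp
  have "emeasure lborel (ball (0::'a) 1) \<le> emeasure lborel (cball (0::'a) 1)"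
    by (intro emeasure_mono) auto
  moreover have "emeasure lborel (ball (0::'a) 1) \<noteq> 0"
    using content_ball_pos[of 1 "0::'a"] by (auto simp: measure_def)
  ultimately have "emeasure lborel (cball (0::'a) 1) \<noteq> 0" by auto
  moreover have "emeasure lborel (cball (0::'a) 1) \<noteq> \<infinity>"
    using emeasure_lborel_cball_finite[of "0::'a" 1] by simp
  ultimately have "(\<integral>\<^sup>+x. ?f (T x) \<partial>lborel) = (\<integral>\<^sup>+x. ?f x \<partial>lborel)"
    using eq unfolding g infinity_ennreal_def by (metis mult_divide_eq_ennreal)
  moreover have "(\<integral>\<^sup>+x. ?f (T x) \<partial>lborel) = emeasure (distr lborel borel T) A"
    using nn_integral_distr[of T lborel borel ?f] A by simp
  ultimately show "emeasure (distr lborel borel T) A = emeasure lborel A"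
    using A by simp
qed

lemma lborel_integral_orthogonal_transformation:
  fixes T :: "'a::euclidean_space \<Rightarrow> 'a" and f :: "'a \<Rightarrow> 'b::{banach, second_countable_topology}"
  assumes T: "orthogonal_transformation T" and f: "f \<in> borel_measurable borel"
  shows "(LINT x|lborel. f (T x)) = (LINT x|lborel. f x)"
proof -
  have "T \<in> borel_measurable borel"
    using T by (intro borel_measurable_continuous_onI linear_continuous_on)
      (simp add: orthogonal_transformation_linear linear_conv_bounded_linear[symmetric])
  then have "(LINT x|distr lborel borel T. f x) = (LINT x|lborel. f (T x))"
    using f by (intro integral_distr) auto
  then show ?thesis
    by (simp add: lborel_distr_orthogonal_transformation[OF T])
qed

section \<open>Integrability of powers of the norm\<close>

text \<open>
  A crude bound by the circumscribed cube; only the exponent of the radius matters below.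
\<close>

lemma emeasure_cball_le:
  assumes "0 \<le> r"
  shows "emeasure lborel (cball (0::'a::euclidean_space) r) \<le> ennreal ((2 * r) ^ DIM('a))"
proof -
  have "cball (0::'a) r \<subseteq> cbox (- (\<Sum>b\<in>Basis. r *\<^sub>R b)) (\<Sum>b\<in>Basis. r *\<^sub>R b)"
  proof
    fix x :: 'a assume "x \<in> cball 0 r"
    then have "\<bar>x \<bullet> b\<bar> \<le> r" if "b \<in> Basis" for b
      using Basis_le_norm[OF that, of x] by simp
    then show "x \<in> cbox (- (\<Sum>b\<in>Basis. r *\<^sub>R b)) (\<Sum>b\<in>Basis. r *\<^sub>R b)"
      by (auto simp: mem_box inner_sum_left inner_Basis if_distrib abs_le_iff minus_le_iff cong: if_cong)
  qed
  then have "emeasure lborel (cball (0::'a) r)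
      \<le> emeasure lborel (cbox (- (\<Sum>b\<in>Basis. r *\<^sub>R b)) (\<Sum>b\<in>Basis. r *\<^sub>R b :: 'a))"
    by (intro emeasure_mono) auto
  also have "\<dots> = ennreal ((2 * r) ^ DIM('a))"
    using assms by (subst emeasure_lborel_cbox) (auto simp: algebra_simps inner_diff_left inner_sum_left inner_Basis if_distrib cong: if_cong)
  finally show ?thesis .
qed

text \<open>
  On the dyadic shell of radius about \<open>2 ^ (- j)\<close> the integrand is at most a constant times \<open>2 ^ (- j a)\<close>, and the
  shell has volume at most a constant times \<open>2 ^ (- j d)\<close>, where \<open>d\<close> is the dimension. The products form a geometric series with ratio
  \<open>q = 2 ^ (- (a + d))\<close>, which converges exactly because \<open>a > - d\<close>. The shells are enlarged to balls, which
  keeps the bound.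
\<close>

lemma integrable_norm_powr_on_unit_ball:
  fixes a :: real
  assumes "- real DIM('a::euclidean_space) < a"
  shows "integrable lborel (\<lambda>x::'a. indicator (cball 0 1) x * norm x powr a)"
proof (rule integrableI_bounded)
  show "(\<lambda>x::'a. indicator (cball 0 1) x * norm x powr a) \<in> borel_measurable lborel"
    by (intro borel_measurable_continuous_onI borel_measurable_times borel_measurable_indicator) measurable
  define q where "q = (1/2) powr (a + DIM('a))"
  define K where "K = 2 powr \<bar>a\<bar> * 2 ^ DIM('a)"
  have q: "0 < q" "q < 1" and K: "0 \<le> K"
    using assms powr_less_mono'[of "1/2" 0 "a + DIM('a)"] by (auto simp: q_def K_def)
  let ?c = "\<lambda>j. 2 powr \<bar>a\<bar> * (1/2) powr (real j * a)"
  let ?h = "\<lambda>j (x::'a). ennreal (?c j) * indicator (cball 0 ((1/2) ^ j)) x"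
  have pt: "ennreal (norm (indicator (cball 0 1) x * norm x powr a)) \<le> (\<Sum>j. ?h j x)" for x :: 'a
  proof (cases "x = 0 \<or> 1 < norm x")
    case True
    then show ?thesis by auto
  next
    case False
    then have x: "0 < norm x" "norm x \<le> 1" by auto
    have "\<exists>n. (1/2) ^ n < norm x"
      using x real_arch_pow_inv[of "norm x" "1/2"] by simp
    \<comment> \<open>With \<open>n\<close> the first index for which \<open>2 ^ (- n) < norm x\<close>, the point lies in the shell of index \<open>n - 1\<close>.\<close>
    define n where "n = (LEAST n. (1/2) ^ n < norm x)"
    have n: "(1/2) ^ n < norm x"
      unfolding n_def by (rule LeastI_ex) fact
    then have "n \<noteq> 0" using x by (cases n) auto
    then obtain j where j: "n = Suc j" by (cases n) auto
    have jn: "norm x \<le> (1/2) ^ j"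
      using not_less_Least[of j "\<lambda>n. (1/2) ^ n < norm x"] j by (simp add: n_def[symmetric])
    \<comment> \<open>On a shell the norm varies by a factor of at most 2, which costs a factor \<open>2 powr \<bar>a\<bar>\<close> for either sign of \<open>a\<close>.\<close>
    have "norm x powr a \<le> ?c j"
    proof -
      define r where "r = norm x / (1/2) ^ j"
      have r: "1/2 \<le> r" "r \<le> 1" using n jn j by (auto simp: r_def field_simps)
      have "r powr a \<le> 2 powr \<bar>a\<bar>"
      proof (cases "a \<ge> 0")
        case True
        then have "r powr a \<le> 1" using r by (simp add: powr_le1)
        also have "1 \<le> 2 powr \<bar>a\<bar>" by (simp add: ge_one_powr_ge_zero)
        finally show ?thesis .
      next
        case False
        then have "r powr a \<le> (1/2) powr a" using r by (intro powr_mono2') auto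
        also have "\<dots> = 2 powr \<bar>a\<bar>" using False by (simp add: powr_divide powr_minus field_simps)
        finally show ?thesis .
      qed
      moreover have "norm x = r * (1/2) powr (real j)"
        by (simp add: r_def powr_realpow)
      then have "norm x powr a = r powr a * (1/2) powr (real j * a)"
        using r by (simp add: powr_mult powr_powr)
      ultimately show ?thesis by (simp add: mult_right_mono)
    qed
    then have "ennreal (norm (indicator (cball 0 1) x * norm x powr a)) \<le> ?h j x"
      using x jn by (simp add: ennreal_leI)
    also have "\<dots> = (\<Sum>j\<in>{j}. ?h j x)"
      by (simp only: sum.insert finite.emptyI empty_iff not_False_eq_True sum.empty add_0_right)
    also have "\<dots> \<le> (\<Sum>j. ?h j x)"
      by (rule sum_le_suminf) (auto intro: summableI)
    finally show ?thesis .
  qed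
  have shell: "(\<integral>\<^sup>+x. ?h j x \<partial>lborel) \<le> ennreal (K * q ^ j)" for j
  proof -
    have "(\<integral>\<^sup>+x. ?h j x \<partial>lborel) = ennreal (?c j) * emeasure lborel (cball (0::'a) ((1/2) ^ j))"
      by (subst nn_integral_cmult_indicator) auto
    also have "\<dots> \<le> ennreal (?c j) * ennreal ((2 * (1/2) ^ j) ^ DIM('a))"
      by (intro mult_left_mono emeasure_cball_le) auto
    also have "\<dots> = ennreal (?c j * (2 * (1/2) ^ j) ^ DIM('a))"
      by (simp add: ennreal_mult)
    also have "?c j * (2 * (1/2) ^ j) ^ DIM('a) = K * q ^ j"
    proof -
      have "q ^ j = (1/2) powr (real j * a) * (1/2) powr (real (j * DIM('a)))"
        by (simp add: q_def powr_powr powr_realpow[symmetric] powr_add[symmetric] algebra_simps del: powr_realpow)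
      also have "(1/2) powr (real (j * DIM('a))) = (((1/2)::real) ^ j) ^ DIM('a)"
        by (subst powr_realpow) (auto simp: power_mult)
      finally show ?thesis by (simp add: K_def power_mult_distrib)
    qed
    finally show ?thesis .
  qed
  have hm: "?h j \<in> borel_measurable lborel" for j
    by (intro borel_measurable_times_ennreal borel_measurable_const borel_measurable_indicator) simp
  have "(\<integral>\<^sup>+x. ennreal (norm (indicator (cball 0 1) x * norm x powr a)) \<partial>(lborel::'a measure))
      \<le> (\<integral>\<^sup>+x. (\<Sum>j. ?h j x) \<partial>lborel)"
    by (intro nn_integral_mono pt)
  also have "\<dots> = (\<Sum>j. \<integral>\<^sup>+x. ?h j x \<partial>lborel)"
    by (rule nn_integral_suminf[OF hm])
  also have "\<dots> \<le> (\<Sum>j. ennreal (K * q ^ j))"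
    by (intro suminf_le shell summableI)
  also have "\<dots> < \<infinity>"
  proof -
    have "summable (\<lambda>j. K * q ^ j)" using q by (intro summable_mult summable_geometric) auto
    then have "(\<Sum>j. ennreal (K * q ^ j)) = ennreal (\<Sum>j. K * q ^ j)"
      using q K by (intro suminf_ennreal2) auto
    then show ?thesis by simp
  qed
  finally show "(\<integral>\<^sup>+x. ennreal (norm (indicator (cball 0 1) x * norm x powr a)) \<partial>(lborel::'a measure)) < \<infinity>" .
qed

section \<open>Convergence from a derivative bound\<close>

text \<open>
  The bound \<open>C / x\<^sup>2\<close> is the derivative of \<open>- C / x\<close>, so the mean value inequality gives
  \<open>norm (f b - f a) \<le> C / a\<close> for all \<open>b \<ge> a\<close>. This Cauchy condition yields a limit along the integers, and again
  shows that \<open>f\<close> follows it.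
\<close>

lemma converges_of_vector_derivative_le_inverse_square:
  fixes f f' :: "real \<Rightarrow> 'a::banach"
  assumes f': "\<And>x. 1 < x \<Longrightarrow> (f has_vector_derivative f' x) (at x)"
    and le: "\<And>x. 1 < x \<Longrightarrow> norm (f' x) \<le> C / x\<^sup>2"
  shows "\<exists>A. (f \<longlongrightarrow> A) at_top"
proof -
  have C: "0 \<le> C" using le[of 2] order_trans[OF norm_ge_zero] by fastforce
  have bound: "norm (f b - f a) \<le> C / a" if "1 < a" "a \<le> b" for a b
  proof (cases "a = b")
    case True
    then show ?thesis using that C by simp
  next
    case False
    have "norm (f b - f a) \<le> - C / b - - C / a"
    proof (rule differentiable_bound_general[where \<phi>' = "\<lambda>x. C / x\<^sup>2" and f' = f'])
      show "a < b" using False that by simp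
      show "continuous_on {a..b} f"
        using that by (intro continuous_at_imp_continuous_on ballI has_vector_derivative_continuous[OF f']) auto
      show "continuous_on {a..b} (\<lambda>x. - C / x)"
        using that by (intro continuous_intros) auto
      fix x assume x: "a < x" "x < b"
      show "(f has_vector_derivative f' x) (at x)" using f' that x by simp
      show "((\<lambda>x. - C / x) has_vector_derivative C / x\<^sup>2) (at x)"
        using that x unfolding has_real_derivative_iff_has_vector_derivative[symmetric]
        by (auto intro!: derivative_eq_intros simp: power2_eq_square)
      show "norm (f' x) \<le> C / x\<^sup>2" using le that x by simp
    qed
    also have "\<dots> \<le> C / a" using that C by simp
    finally show ?thesis .
  qed
  have lim0: "((\<lambda>x. C / x) \<longlongrightarrow> 0) at_top"
    by (intro tendsto_divide_0[OF tendsto_const] filterlim_at_top_imp_at_infinity filterlim_ident)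
  have "Cauchy (\<lambda>n. f (real n))"
  proof (rule CauchyI')
    fix e :: real assume "0 < e"
    then have "eventually (\<lambda>x. C / x < e) at_top"
      using order_tendstoD(2)[OF lim0] by simp
    then obtain M where M: "\<And>x. M \<le> x \<Longrightarrow> C / x < e"
      by (auto simp: eventually_at_top_linorder)
    obtain m :: nat where m: "max M 2 \<le> real m" using real_arch_simple by blast
    have "dist (f (real k)) (f (real n)) < e" if "m \<le> k" "k < n" for k n
      using bound[of "real k" "real n"] M[of "real k"] m that
      by (auto simp: dist_norm norm_minus_commute)
    then show "\<exists>M. \<forall>m\<ge>M. \<forall>n>m. dist (f (real m)) (f (real n)) < e" by blast
  qed
  then obtain A where A: "(\<lambda>n. f (real n)) \<longlonglongrightarrow> A"
    using Cauchy_convergent convergent_def by blast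
  have "norm (A - f x) \<le> C / x" if "1 < x" for x
  proof (rule tendsto_upperbound)
    show "(\<lambda>n. norm (f (real n) - f x)) \<longlonglongrightarrow> norm (A - f x)"
      by (intro tendsto_intros A)
    have "eventually (\<lambda>n. x \<le> real n) sequentially"
      using filterlim_real_sequentially by (simp add: filterlim_at_top)
    then show "eventually (\<lambda>n. norm (f (real n) - f x) \<le> C / x) sequentially"
      using bound that by (auto elim: eventually_mono)
  qed simp
  then have "eventually (\<lambda>x. norm (f x - A) \<le> C / x) at_top"
    by (auto simp: norm_minus_commute intro: eventually_mono[OF eventually_gt_at_top[of 1]])
  then have "((\<lambda>x. f x - A) \<longlongrightarrow> 0) at_top"
    by (rule Lim_null_comparison) (rule lim0)
  then have "(f \<longlongrightarrow> A) at_top" by (rule Lim_null[THEN iffD2])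
  then show ?thesis ..
qed

section \<open>Cutoff integrals\<close>

lemma cutoff_integral_rescale:
  fixes \<psi> :: "real^'n \<Rightarrow> complex"
  assumes "\<psi> \<in> borel_measurable borel" "0 < N"
  shows "(LINT \<eta>|lborel. cutoff_integrand s \<psi> \<omega> N \<eta>)
    = of_real (N ^ CARD('n) * N powr (2 * s)) *
      (LINT x|lborel. of_real (norm x powr (2 * s)) * \<psi> x * exp (\<i> * of_real (N * (\<omega> \<bullet> x))))"
proof -
  have [measurable]: "\<psi> \<in> borel_measurable borel" by fact
  have "(\<lambda>\<eta>. cutoff_integrand s \<psi> \<omega> N \<eta>) \<in> borel_measurable borel"
    unfolding cutoff_integrand_def by measurable
  then have "(LINT \<eta>|lborel. cutoff_integrand s \<psi> \<omega> N \<eta>)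
      = of_real (N ^ DIM(real^'n)) * (LINT x|lborel. cutoff_integrand s \<psi> \<omega> N (N *\<^sub>R x))"
    using assms by (intro lborel_integral_scaleR) auto
  also have "(\<lambda>x. cutoff_integrand s \<psi> \<omega> N (N *\<^sub>R x)) = (\<lambda>x. of_real (N powr (2 * s)) *
      (of_real (norm x powr (2 * s)) * \<psi> x * exp (\<i> * of_real (N * (\<omega> \<bullet> x)))))"
    using assms by (simp add: cutoff_integrand_def powr_mult fun_eq_iff mult_ac)
  finally show ?thesis by simp
qed

text \<open>
  After the substitution \<open>\<eta> = N x\<close> the integral is \<open>N ^ d * N powr (2 * s)\<close> times an oscillatory integral of frequency
  \<open>N\<close>, where \<open>d\<close> is the dimension. Its amplitude \<open>norm x powr (2 * s) * \<psi> x\<close> is smooth since \<open>\<psi>\<close> vanishes near the origin. Taking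
  \<open>k \<ge> m + d + 2 s\<close> integrations by parts absorbs the growing prefactor and leaves \<open>N ^ m\<close> in the denominator.
\<close>

lemma cutoff_integral_rapid_decay:
  fixes \<psi> :: "real^'n \<Rightarrow> complex"
  assumes smooth: "\<And>k. C_k k \<psi>" and "0 < \<epsilon>"
    and inner: "\<And>x. norm x < \<epsilon> \<Longrightarrow> \<psi> x = 0" and outer: "\<And>x. R < norm x \<Longrightarrow> \<psi> x = 0"
    and "norm \<omega> = 1"
  shows "\<exists>C. \<forall>N\<ge>1. norm (LINT \<eta>|lborel. cutoff_integrand s \<psi> \<omega> N \<eta>) \<le> C / N ^ m"
proof -
  define k where "k = nat \<lceil>m + CARD('n) + 2 * s\<rceil>"
  have k: "m + CARD('n) + 2 * s \<le> k" unfolding k_def by linarith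
  let ?G = "\<lambda>x. of_real (norm x powr (2 * s)) * \<psi> x"
  have "C_k k ?G"
    using smooth \<open>0 < \<epsilon>\<close> inner by (rule C_k_norm_powr_mult)
  then obtain C where C: "\<And>N. 0 < N \<Longrightarrow>
      norm (LINT x|lborel. ?G x * exp (\<i> * of_real (N * (\<omega> \<bullet> x)))) \<le> C / N ^ k"
    using oscillatory_integral_decay[of k ?G R \<omega>] outer \<open>norm \<omega> = 1\<close> by auto
  have C0: "0 \<le> C" using C[of 1] order_trans[OF norm_ge_zero] by fastforce
  have \<psi>m: "\<psi> \<in> borel_measurable borel"
    using smooth[of 0] by (intro borel_measurable_continuous_onI) simp
  have "norm (LINT \<eta>|lborel. cutoff_integrand s \<psi> \<omega> N \<eta>) \<le> C / N ^ m" if N: "1 \<le> N" for N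
  proof -
    have "norm (LINT \<eta>|lborel. cutoff_integrand s \<psi> \<omega> N \<eta>)
        = (N ^ CARD('n) * N powr (2 * s)) * norm (LINT x|lborel. ?G x * exp (\<i> * of_real (N * (\<omega> \<bullet> x))))"
      using N by (simp only: cutoff_integral_rescale[OF \<psi>m] norm_mult norm_of_real) (simp add: abs_mult)
    also have "\<dots> \<le> (N ^ CARD('n) * N powr (2 * s)) * (C / N ^ k)"
      using N by (intro mult_left_mono C) auto
    also have "\<dots> = C * N powr (CARD('n) + 2 * s - k)"
      using N by (simp add: powr_add powr_diff powr_realpow)
    also have "\<dots> \<le> C * N powr (- real m)"
      using N C0 k by (intro mult_left_mono powr_mono) auto
    also have "\<dots> = C / N ^ m"
      using N by (simp add: powr_minus powr_realpow divide_inverse)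
    finally show ?thesis .
  qed
  then show ?thesis by blast
qed

lemma lborel_integrable_scaleR:
  fixes f :: "'a::euclidean_space \<Rightarrow> 'b::{banach, second_countable_topology}"
  assumes "integrable lborel f" "0 < c"
  shows "integrable lborel (\<lambda>x. f (c *\<^sub>R x))"
proof -
  have [measurable]: "f \<in> borel_measurable borel"
    using borel_measurable_integrable[OF assms(1)] by simp
  have "integrable (density (distr lborel borel (\<lambda>x::'a. 0 + c *\<^sub>R x)) (\<lambda>_. ennreal (\<bar>c\<bar> ^ DIM('a)))) f"
    using assms lborel_affine[of c "0::'a"] by simp
  then have "integrable (distr lborel borel (\<lambda>x::'a. 0 + c *\<^sub>R x)) (\<lambda>x. c ^ DIM('a) *\<^sub>R f x)"
    using assms(2) by (subst (asm) integrable_density) auto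
  then have "integrable lborel (\<lambda>x. c ^ DIM('a) *\<^sub>R f (c *\<^sub>R x))"
    by (subst (asm) integrable_distr_eq) auto
  then have "integrable lborel (\<lambda>x. inverse (c ^ DIM('a)) *\<^sub>R (c ^ DIM('a) *\<^sub>R f (c *\<^sub>R x)))"
    by (rule integrable_scaleR_right)
  then show ?thesis
    using assms(2) by simp
qed

text \<open>
  The integrand is dominated by a constant times \<open>norm \<eta> powr (2 * s)\<close> on the ball of radius \<open>N\<close>, which is a rescaled copy of
  the integrable function on the unit ball.
\<close>

lemma integrable_cutoff_integrand:
  fixes \<phi> :: "real^'n \<Rightarrow> complex"
  assumes s: "- (real CARD('n) / 2) < s"
    and cont: "continuous_on UNIV \<phi>" and supp: "\<And>x. 1 < norm x \<Longrightarrow> \<phi> x = 0" and N: "0 < N"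
  shows "integrable lborel (cutoff_integrand s \<phi> \<omega> N)"
proof -
  have \<phi>m [measurable]: "\<phi> \<in> borel_measurable borel"
    using cont by (intro borel_measurable_continuous_onI)
  have "compact (\<phi> ` cball 0 1)"
    using cont by (intro compact_continuous_image) (auto intro: continuous_on_subset)
  then obtain B where B: "\<And>x. norm x \<le> 1 \<Longrightarrow> norm (\<phi> x) \<le> B"
    by (force dest!: compact_imp_bounded simp: bounded_iff)
  let ?h = "\<lambda>x::real^'n. indicator (cball 0 1) x * norm x powr (2 * s)"
  have "integrable lborel ?h"
    using s by (intro integrable_norm_powr_on_unit_ball) simp
  then have h: "integrable lborel (\<lambda>x. ?h (x /\<^sub>R N))"
    using N by (intro lborel_integrable_scaleR) auto
  show ?thesis
  proof (rule Bochner_Integration.integrable_bound)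
    show "integrable lborel (\<lambda>x. (B * N powr (2 * s)) * ?h (x /\<^sub>R N))"
      using h by (rule integrable_mult_right)
    show "cutoff_integrand s \<phi> \<omega> N \<in> borel_measurable lborel"
      unfolding cutoff_integrand_def[abs_def] by measurable
    have "norm (cutoff_integrand s \<phi> \<omega> N x) \<le> B * N powr (2 * s) * ?h (x /\<^sub>R N)" for x
    proof (cases "norm (x /\<^sub>R N) \<le> 1")
      case True
      have "norm x powr (2 * s) = N powr (2 * s) * norm (x /\<^sub>R N) powr (2 * s)"
        using N by (simp add: powr_mult[symmetric] mult.assoc[symmetric])
      moreover have "norm (cutoff_integrand s \<phi> \<omega> N x) = norm (\<phi> (x /\<^sub>R N)) * norm x powr (2 * s)"
        by (simp add: cutoff_integrand_def norm_mult)
      moreover have "norm (\<phi> (x /\<^sub>R N)) * norm x powr (2 * s) \<le> B * norm x powr (2 * s)"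
        using B[OF True] by (rule mult_right_mono) simp
      ultimately show ?thesis
        using True by simp
    next
      case False
      then show ?thesis by (simp add: cutoff_integrand_def supp)
    qed
    then show "AE x in lborel. norm (cutoff_integrand s \<phi> \<omega> N x) \<le> norm (B * N powr (2 * s) * ?h (x /\<^sub>R N))"
      using abs_ge_self order_trans by (fastforce intro!: AE_I2)
  qed
qed

text \<open>
  Differentiating \<open>\<phi> (\<eta> / N)\<close> in \<open>N\<close> gives \<open>- \<psi> (\<eta> / N) / N\<close> with the radial derivative \<open>\<psi>\<close>. Differentiation under
  the integral sign asks for this derivative, times the weight, to be jointly continuous in \<open>N\<close> and \<open>\<eta>\<close>. It is, even where the weight
  is singular: \<open>\<phi>\<close> is constant near the origin, so \<open>\<psi>\<close> vanishes there.
\<close>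

lemma has_vector_derivative_cutoff_integral:
  fixes \<phi> :: "real^'n \<Rightarrow> complex"
  defines "\<psi> \<equiv> \<lambda>x. frechet_derivative \<phi> (at x) x"
  assumes s: "- (real CARD('n) / 2) < s" and C1: "C_k 1 \<phi>"
    and \<epsilon>: "0 < \<epsilon>" and inner: "\<And>x. norm x < \<epsilon> \<Longrightarrow> \<phi> x = 1" and outer: "\<And>x. 1 < norm x \<Longrightarrow> \<phi> x = 0"
    and N0: "0 < N0"
  shows "((\<lambda>N. LINT \<eta>|lborel. cutoff_integrand s \<phi> \<omega> N \<eta>) has_vector_derivative
      - (LINT \<eta>|lborel. cutoff_integrand s \<psi> \<omega> N0 \<eta>) /\<^sub>R N0) (at N0)"
proof -
  let ?U = "{0<..<N0 + 1}"
  obtain a b :: "real^'n" where ab: "cball 0 (N0 + 1) \<subseteq> cbox a b"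
    by (rule obtain_cbox)
  have diff: "\<phi> differentiable (at x)" for x
    using C1 by simp
  have \<phi>c: "continuous_on UNIV \<phi>"
    using C1 by (rule C_k_continuous)
  have \<psi>C: "C_k 0 \<psi>"
    unfolding \<psi>_def using C1 by (intro C_k_radial_derivative) simp
  have \<psi>_inner: "\<psi> x = 0" if "norm x < \<epsilon>" for x
    using that inner unfolding \<psi>_def
    by (intro frechet_derivative_eq_0_if_locally_const[of "ball 0 \<epsilon>" _ _ 1]) auto
  have \<psi>_outer: "\<psi> x = 0" if "1 < norm x" for x
    using that outer unfolding \<psi>_def
    by (intro frechet_derivative_eq_0_if_locally_const[of "- cball 0 1" _ _ 0]) auto
  have out: "1 < norm (\<eta> /\<^sub>R N)" if "N \<in> ?U" "\<eta> \<notin> cbox a b" for N \<eta>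
  proof -
    have "N0 + 1 < norm \<eta>" using that ab by (meson mem_cball_0 not_le subsetD)
    then show ?thesis using that by (simp add: field_simps)
  qed
  have cut: "cutoff_integrand s h \<omega> N integrable_on cbox a b"
      "integral (cbox a b) (cutoff_integrand s h \<omega> N) = (LINT \<eta>|lborel. cutoff_integrand s h \<omega> N \<eta>)"
    if "continuous_on UNIV h" "\<And>x. 1 < norm x \<Longrightarrow> h x = 0" "N \<in> ?U" for h :: "real^'n \<Rightarrow> complex" and N
  proof -
    have int: "integrable lborel (cutoff_integrand s h \<omega> N)"
      using s that by (intro integrable_cutoff_integrand) auto
    have zero: "cutoff_integrand s h \<omega> N \<eta> = 0" if "\<eta> \<notin> cbox a b" for \<eta>
      using out[OF \<open>N \<in> ?U\<close> that] \<open>\<And>x. 1 < norm x \<Longrightarrow> h x = 0\<close> by (simp add: cutoff_integrand_def)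
    show "cutoff_integrand s h \<omega> N integrable_on cbox a b"
      using int zero by (rule integral_cbox_eq_lborel(1))
    show "integral (cbox a b) (cutoff_integrand s h \<omega> N) = (LINT \<eta>|lborel. cutoff_integrand s h \<omega> N \<eta>)"
      using int zero by (rule integral_cbox_eq_lborel(2))
  qed
  have "((\<lambda>N. integral (cbox a b) (cutoff_integrand s \<phi> \<omega> N)) has_vector_derivative
      integral (cbox a b) (\<lambda>\<eta>. - cutoff_integrand s \<psi> \<omega> N0 \<eta> /\<^sub>R N0)) (at N0 within ?U)"
  proof (rule leibniz_rule_vector_derivative)
    fix N and \<eta> :: "real^'n" assume N: "N \<in> ?U"
    let ?D = "frechet_derivative \<phi> (at (\<eta> /\<^sub>R N))"
    have "(\<phi> has_derivative ?D) (at (\<eta> /\<^sub>R N))"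
      using diff frechet_derivative_works by blast
    moreover have "((\<lambda>N. \<eta> /\<^sub>R N) has_derivative (\<lambda>h. h *\<^sub>R ((- 1 / N) *\<^sub>R (\<eta> /\<^sub>R N)))) (at N within ?U)"
      using N by (auto intro!: derivative_eq_intros simp: fun_eq_iff field_simps power2_eq_square)
    ultimately have "((\<lambda>N. \<phi> (\<eta> /\<^sub>R N)) has_derivative (\<lambda>h. ?D (h *\<^sub>R ((- 1 / N) *\<^sub>R (\<eta> /\<^sub>R N))))) (at N within ?U)"
      by (rule has_derivative_compose[rotated])
    moreover have "linear ?D"
      using diff by (simp add: linear_frechet_derivative)
    ultimately have "((\<lambda>N. \<phi> (\<eta> /\<^sub>R N)) has_vector_derivative (- 1 / N) *\<^sub>R \<psi> (\<eta> /\<^sub>R N)) (at N within ?U)"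
      unfolding has_vector_derivative_def \<psi>_def by (simp only: linear_scale)
    then have "((\<lambda>N. cutoff_integrand s \<phi> \<omega> N \<eta>) has_vector_derivative
        of_real (norm \<eta> powr (2 * s)) * ((- 1 / N) *\<^sub>R \<psi> (\<eta> /\<^sub>R N)) * exp (\<i> * of_real (\<omega> \<bullet> \<eta>))) (at N within ?U)"
      unfolding cutoff_integrand_def
      by (intro has_vector_derivative_mult_left has_vector_derivative_mult_right)
    then show "((\<lambda>N. cutoff_integrand s \<phi> \<omega> N \<eta>) has_vector_derivative
        - cutoff_integrand s \<psi> \<omega> N \<eta> /\<^sub>R N) (at N within ?U)"
      by (simp add: cutoff_integrand_def divide_inverse)
  next
    show "cutoff_integrand s \<phi> \<omega> N integrable_on cbox a b" if "N \<in> ?U" for N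
      using \<phi>c outer that by (rule cut)
    \<comment> \<open>The weight is moved into the scaled variable, \<open>norm \<eta> powr (2 s) = N powr (2 s) * norm (\<eta> / N) powr (2 s)\<close>, so that continuity of one function of \<open>\<eta> / N\<close> suffices.\<close>
    have P: "continuous_on UNIV (\<lambda>x. of_real (norm x powr (2 * s)) * \<psi> x)"
      using C_k_norm_powr_mult[OF \<psi>C \<epsilon> \<psi>_inner, of "2 * s"] by simp
    have "continuous_on (?U \<times> cbox a b) (\<lambda>(N, \<eta>). - (of_real (N powr (2 * s)) *
        (of_real (norm (\<eta> /\<^sub>R N) powr (2 * s)) * \<psi> (\<eta> /\<^sub>R N)) * exp (\<i> * of_real (\<omega> \<bullet> \<eta>))) /\<^sub>R N)"
      unfolding split_beta
      by (intro continuous_intros continuous_on_compose2[OF P]) auto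
    also have "?this \<longleftrightarrow> continuous_on (?U \<times> cbox a b) (\<lambda>(N, \<eta>). - cutoff_integrand s \<psi> \<omega> N \<eta> /\<^sub>R N)"
    proof (intro continuous_on_cong refl, clarify)
      fix N and \<eta> :: "real^'n" assume "N \<in> ?U"
      then have "norm \<eta> powr (2 * s) = N powr (2 * s) * norm (\<eta> /\<^sub>R N) powr (2 * s)"
        by (simp add: powr_mult[symmetric] mult.assoc[symmetric])
      then show "- (of_real (N powr (2 * s)) * (of_real (norm (\<eta> /\<^sub>R N) powr (2 * s)) * \<psi> (\<eta> /\<^sub>R N))
          * exp (\<i> * of_real (\<omega> \<bullet> \<eta>))) /\<^sub>R N = - cutoff_integrand s \<psi> \<omega> N \<eta> /\<^sub>R N"
        by (simp only: cutoff_integrand_def of_real_mult mult.assoc)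
    qed
    finally show "continuous_on (?U \<times> cbox a b) (\<lambda>(N, \<eta>). - cutoff_integrand s \<psi> \<omega> N \<eta> /\<^sub>R N)" .
  qed (use N0 in auto)
  then have "((\<lambda>N. LINT \<eta>|lborel. cutoff_integrand s \<phi> \<omega> N \<eta>) has_vector_derivative
      integral (cbox a b) (\<lambda>\<eta>. - cutoff_integrand s \<psi> \<omega> N0 \<eta> /\<^sub>R N0)) (at N0 within ?U)"
    by (rule has_vector_derivative_transform[rotated 2]) (use N0 cut(2)[OF \<phi>c outer] in auto)
  moreover have "integral (cbox a b) (\<lambda>\<eta>. - cutoff_integrand s \<psi> \<omega> N0 \<eta> /\<^sub>R N0)
      = - (LINT \<eta>|lborel. cutoff_integrand s \<psi> \<omega> N0 \<eta>) /\<^sub>R N0"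
    using cut(2)[of \<psi> N0] \<psi>C \<psi>_outer N0 by simp
  ultimately show ?thesis
    using N0 by (simp add: at_within_open[of N0 ?U])
qed

text \<open>
  The radial derivative of the cutoff vanishes near the origin and outside the unit ball, so the integral that it produces is
  \<open>O(1 / N)\<close>. Hence the \<open>N\<close>-derivative of the cutoff integral is \<open>O(1 / N\<^sup>2)\<close>.
\<close>

lemma cutoff_integral_converges:
  fixes \<phi> :: "real^'n \<Rightarrow> complex"
  assumes s: "- (real CARD('n) / 2) < s" and smooth: "\<And>k. C_k k \<phi>"
    and \<epsilon>: "0 < \<epsilon>" and inner: "\<And>x. norm x < \<epsilon> \<Longrightarrow> \<phi> x = 1" and outer: "\<And>x. 1 < norm x \<Longrightarrow> \<phi> x = 0"
    and \<omega>: "norm \<omega> = 1"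
  shows "\<exists>A. ((\<lambda>N. LINT \<eta>|lborel. cutoff_integrand s \<phi> \<omega> N \<eta>) \<longlongrightarrow> A) at_top"
proof -
  let ?\<psi> = "\<lambda>x. frechet_derivative \<phi> (at x) x"
  have "C_k k ?\<psi>" for k
    using smooth by (rule C_k_radial_derivative)
  moreover have "?\<psi> x = 0" if "norm x < \<epsilon>" for x
    using that inner by (intro frechet_derivative_eq_0_if_locally_const[of "ball 0 \<epsilon>" _ _ 1]) auto
  moreover have "?\<psi> x = 0" if "1 < norm x" for x
    using that outer by (intro frechet_derivative_eq_0_if_locally_const[of "- cball 0 1" _ _ 0]) auto
  ultimately obtain C where C: "\<And>N. 1 \<le> N \<Longrightarrow>
      norm (LINT \<eta>|lborel. cutoff_integrand s ?\<psi> \<omega> N \<eta>) \<le> C / N ^ 1"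
    using cutoff_integral_rapid_decay[of ?\<psi> \<epsilon> 1 \<omega> s 1] \<epsilon> \<omega> by blast
  show ?thesis
  proof (rule converges_of_vector_derivative_le_inverse_square)
    fix N :: real assume N: "1 < N"
    show "((\<lambda>N. LINT \<eta>|lborel. cutoff_integrand s \<phi> \<omega> N \<eta>) has_vector_derivative
        - (LINT \<eta>|lborel. cutoff_integrand s ?\<psi> \<omega> N \<eta>) /\<^sub>R N) (at N)"
      using N by (intro has_vector_derivative_cutoff_integral[OF s smooth \<epsilon> inner outer]) auto
    show "norm (- (LINT \<eta>|lborel. cutoff_integrand s ?\<psi> \<omega> N \<eta>) /\<^sub>R N) \<le> C / N\<^sup>2"
      using C[of N] N by (simp add: field_simps power2_eq_square)
  qed
qed

lemma cutoff_integral_orthogonal_invariant: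
  fixes \<phi> :: "real^'n \<Rightarrow> complex"
  assumes "\<phi> \<in> borel_measurable borel" "radial \<phi>" "orthogonal_transformation T"
  shows "(LINT \<eta>|lborel. cutoff_integrand s \<phi> (T \<omega>) N \<eta>) = (LINT \<eta>|lborel. cutoff_integrand s \<phi> \<omega> N \<eta>)"
proof -
  have [measurable]: "\<phi> \<in> borel_measurable borel" by fact
  have "norm (T \<eta> /\<^sub>R N) = norm (\<eta> /\<^sub>R N)" for \<eta>
    using orthogonal_transformation_norm[OF assms(3)] by simp
  then have "\<phi> (T \<eta> /\<^sub>R N) = \<phi> (\<eta> /\<^sub>R N)" for \<eta>
    using assms(2) unfolding radial_def by blast
  then have "cutoff_integrand s \<phi> (T \<omega>) N (T \<eta>) = cutoff_integrand s \<phi> \<omega> N \<eta>" for \<eta>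
    using assms(3) orthogonal_transformation_norm[OF assms(3)]
    by (simp add: cutoff_integrand_def orthogonal_transformation_def)
  moreover have "cutoff_integrand s \<phi> (T \<omega>) N \<in> borel_measurable borel"
    unfolding cutoff_integrand_def[abs_def] by measurable
  ultimately show ?thesis
    using lborel_integral_orthogonal_transformation[OF assms(3), of "cutoff_integrand s \<phi> (T \<omega>) N"]
    by simp
qed

theorem lemma1p11:
  fixes s :: real
  assumes "- (real CARD('n::finite) / 2) < s" and "s < 1"
  shows "\<exists>A::complex. \<forall>(\<omega>::real^'n) \<phi>.
           norm \<omega> = 1 \<longrightarrow> radial_cutoff \<phi> \<longrightarrow>
             (\<forall>N>0. integrable lborel (cutoff_integrand s \<phi> \<omega> N)) \<and>
             ((\<lambda>N::real. LINT \<eta>|lborel. cutoff_integrand s \<phi> \<omega> N \<eta>) \<longlongrightarrow> A) at_top"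
proof -
  let ?I = "\<lambda>\<phi> (\<omega>::real^'n) N. LINT \<eta>|lborel. cutoff_integrand s \<phi> \<omega> N \<eta>"
  have cutoff: "C_k k \<phi>" "continuous_on UNIV \<phi>" "\<phi> \<in> borel_measurable borel" "radial \<phi>"
      "norm x < 1/2 \<Longrightarrow> \<phi> x = 1" "1 < norm x \<Longrightarrow> \<phi> x = 0"
    if "radial_cutoff \<phi>" for \<phi> :: "real^'n \<Rightarrow> complex" and k x
  proof -
    show C: "C_k k \<phi>" for k
      using that by (simp add: radial_cutoff_def test_function_def smooth_def)
    show c: "continuous_on UNIV \<phi>" using C[of 0] by simp
    then show "\<phi> \<in> borel_measurable borel" by (rule borel_measurable_continuous_onI)
  qed (use that in \<open>auto simp: radial_cutoff_def\<close>)
  have int: "integrable lborel (cutoff_integrand s \<phi> \<omega> N)"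
    if "radial_cutoff \<phi>" "0 < N" for \<phi> :: "real^'n \<Rightarrow> complex" and \<omega> N
    using assms(1) cutoff(2,6)[OF that(1)] that(2) by (rule integrable_cutoff_integrand)
  \<comment> \<open>The limit is taken from one fixed cutoff and one fixed direction; without any cutoff there is nothing to show.\<close>
  show ?thesis
  proof (cases "\<exists>\<phi> :: real^'n \<Rightarrow> complex. radial_cutoff \<phi>")
    case False
    then show ?thesis by blast
  next
    case True
    then obtain \<phi>\<^sub>0 :: "real^'n \<Rightarrow> complex" where \<phi>\<^sub>0: "radial_cutoff \<phi>\<^sub>0" by blast
    obtain \<omega>\<^sub>0 :: "real^'n" where \<omega>\<^sub>0: "norm \<omega>\<^sub>0 = 1"
      using vector_choose_size[of 1] by auto
    have "\<exists>A. (?I \<phi>\<^sub>0 \<omega>\<^sub>0 \<longlongrightarrow> A) at_top"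
      by (rule cutoff_integral_converges[OF assms(1) cutoff(1)[OF \<phi>\<^sub>0] half_gt_zero[OF zero_less_one]
          cutoff(5,6)[OF \<phi>\<^sub>0] \<omega>\<^sub>0])
    then obtain A where A: "(?I \<phi>\<^sub>0 \<omega>\<^sub>0 \<longlongrightarrow> A) at_top" ..
    have "(?I \<phi> \<omega> \<longlongrightarrow> A) at_top" if \<omega>: "norm \<omega> = 1" and \<phi>: "radial_cutoff \<phi>" for \<omega> \<phi>
    proof -
      obtain T where T: "orthogonal_transformation T" "T \<omega>\<^sub>0 = \<omega>"
        using orthogonal_transformation_exists_1[OF \<omega>\<^sub>0 \<omega>] by blast
      have rot: "?I \<phi> \<omega> N = ?I \<phi> \<omega>\<^sub>0 N" for N
        using cutoff_integral_orthogonal_invariant[OF cutoff(3,4)[OF \<phi>] T(1), of s \<omega>\<^sub>0 N] T(2) by simp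
      let ?\<psi> = "\<lambda>x. \<phi> x - \<phi>\<^sub>0 x"
      \<comment> \<open>Both cutoffs are 1 near the origin, so their difference falls under the rapid decay lemma.\<close>
      have "C_k k ?\<psi>" for k
        using cutoff(1)[OF \<phi>] cutoff(1)[OF \<phi>\<^sub>0] by (rule C_k_diff)
      then obtain C where C: "\<And>N. 1 \<le> N \<Longrightarrow> norm (?I ?\<psi> \<omega>\<^sub>0 N) \<le> C / N ^ 1"
        using cutoff_integral_rapid_decay[of ?\<psi> "1/2" 1 \<omega>\<^sub>0 s 1] cutoff(5,6)[OF \<phi>] cutoff(5,6)[OF \<phi>\<^sub>0] \<omega>\<^sub>0
        by auto
      have diff: "?I ?\<psi> \<omega>\<^sub>0 N = ?I \<phi> \<omega>\<^sub>0 N - ?I \<phi>\<^sub>0 \<omega>\<^sub>0 N" if "1 \<le> N" for N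
      proof -
        have "cutoff_integrand s ?\<psi> \<omega>\<^sub>0 N \<eta> = cutoff_integrand s \<phi> \<omega>\<^sub>0 N \<eta> - cutoff_integrand s \<phi>\<^sub>0 \<omega>\<^sub>0 N \<eta>" for \<eta>
          by (simp add: cutoff_integrand_def algebra_simps)
        then show ?thesis using that int[OF \<phi>] int[OF \<phi>\<^sub>0] by simp
      qed
      have "eventually (\<lambda>N. norm (?I \<phi> \<omega>\<^sub>0 N - ?I \<phi>\<^sub>0 \<omega>\<^sub>0 N) \<le> C / N) at_top"
        using C diff by (intro eventually_mono[OF eventually_ge_at_top[of 1]]) force
      moreover have "((\<lambda>N. C / N) \<longlongrightarrow> 0) at_top"
        by (intro tendsto_divide_0[OF tendsto_const] filterlim_at_top_imp_at_infinity filterlim_ident)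
      ultimately have "((\<lambda>N. ?I \<phi> \<omega>\<^sub>0 N - ?I \<phi>\<^sub>0 \<omega>\<^sub>0 N) \<longlongrightarrow> 0) at_top"
        by (rule Lim_null_comparison)
      then show ?thesis
        unfolding rot using A by (rule Lim_transform[rotated])
    qed
    then show ?thesis using int by blast
  qed
qed

end
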